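(* Let $N\ge 1$, $p>1$, $1<q<\frac{2p}{p+1}$ and $M>0$. Then there exists a constant $c_{N,p,q}>0$, depending only on $N,p,q$, such that there is no positive solution $u$ of $$-\Delta u=|u|^{p-1}u+M|\nabla u|^q\quad\text{in }\mathbb{R}^N$$ satisfying $$u(x)\le c_{N,p,q}\,M^{\frac{2}{2p-(p+1)q}}\qquad\text{for all }x\in\mathbb{R}^N .$$
   Context: Solutions are classical ($C^2$). *)

theory Defs
  imports "HOL-Analysis.Analysis"
begin

definition partial_deriv :: "'n::finite \<Rightarrow> (real ^ 'n \<Rightarrow> real) \<Rightarrow> real ^ 'n \<Rightarrow> real" where
  "partial_deriv i f x = frechet_derivative f (at x) (axis i 1)"

definition gradient :: "(real ^ 'n::finite \<Rightarrow> real) \<Rightarrow> real ^ 'n \<Rightarrow> real ^ 'n" where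
  "gradient f x = (\<chi> i. partial_deriv i f x)"

definition laplacian :: "(real ^ 'n::finite \<Rightarrow> real) \<Rightarrow> real ^ 'n \<Rightarrow> real" where
  "laplacian f x = (\<Sum>i\<in>UNIV. partial_deriv i (partial_deriv i f) x)"

definition C1 :: "(real ^ 'n::finite \<Rightarrow> real) \<Rightarrow> bool" where
  "C1 f \<longleftrightarrow> (\<forall>x. f differentiable at x) \<and> (\<forall>i. continuous_on UNIV (partial_deriv i f))"

definition C2 :: "(real ^ 'n::finite \<Rightarrow> real) \<Rightarrow> bool" where
  "C2 f \<longleftrightarrow> C1 f \<and> (\<forall>i. C1 (partial_deriv i f))"

(* The base of the last power may be 0; "0 powr q = 0" is the intended value for q > 0. *)
definition classical_solution ::
    "real \<Rightarrow> real \<Rightarrow> real \<Rightarrow> (real ^ 'n::finite \<Rightarrow> real) \<Rightarrow> bool" where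
  "classical_solution p q M u \<longleftrightarrow> C2 u \<and>
     (\<forall>x. - laplacian u x = \<bar>u x\<bar> powr (p - 1) * u x + M * norm (gradient u x) powr q)"

end

theory Submission
  imports Defs
begin

text \<open>Let \<open>m = sup u\<close>. Where \<open>m/2 \<le> u\<close> one has \<open>-\<Delta> u \<ge> (m/2)^p\<close>, so if \<open>u\<close> is \<open>L\<close>-Lipschitz,
  comparison with a paraboloid on the ball of radius \<open>m/(4L)\<close> around an almost-maximum point gives
  \<open>m^(p+1) \<le> C L^2\<close>. On the other hand \<open>u\<close> is \<open>L\<close>-Lipschitz as soon as \<open>M L^q\<close> is a suitable multiple
  of \<open>m^p\<close>, and since \<open>q < 2p/(p+1)\<close> the two facts bound \<open>m\<close> from below.

  The Lipschitz bound is a Bernstein argument with the variables doubled, so that no third derivatives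
  of \<open>u\<close> are needed. The function \<open>v = -2m ln (1 - u/(2m))\<close> solves \<open>-\<Delta> v = F(u, |\<nabla> v|)\<close> with
  \<open>F(u, s) = u^p/g + M g^(q-1) s^q - s^2/(2m)\<close> and \<open>g = 1 - u/(2m)\<close>, and \<open>F(\<cdot>, L)\<close> is strictly
  decreasing. At a maximum of \<open>v x - v y - L |x - y| - \<delta> |x|^2\<close> both gradients have norm close to
  \<open>L\<close>, while moving \<open>x\<close> and \<open>y\<close> simultaneously along each axis shows
  \<open>\<Delta> v x - \<Delta> v y \<le> O(\<delta>)\<close>; for small \<open>\<delta>\<close> this contradicts the monotonicity of \<open>F\<close>.\<close>


section \<open>Calculus along the coordinate axes\<close>

lemma has_derivative_gradient:
  fixes f :: "real ^ 'n::finite \<Rightarrow> real"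
  assumes "f differentiable at x"
  shows "(f has_derivative (\<lambda>h. gradient f x \<bullet> h)) (at x)"
proof -
  have D: "(f has_derivative frechet_derivative f (at x)) (at x)"
    using assms frechet_derivative_works by blast
  interpret linear "frechet_derivative f (at x)"
    using D has_derivative_linear by blast
  have "frechet_derivative f (at x) h = gradient f x \<bullet> h" for h
  proof -
    have "h = (\<Sum>i\<in>UNIV. h $ i *\<^sub>R axis i 1)"
      using basis_expansion[of h] by (simp add: scalar_mult_eq_scaleR)
    then have "frechet_derivative f (at x) h =
        frechet_derivative f (at x) (\<Sum>i\<in>UNIV. h $ i *\<^sub>R axis i 1)"
      by simp
    also have "\<dots> = (\<Sum>i\<in>UNIV. h $ i * frechet_derivative f (at x) (axis i 1))"
      by (simp add: sum scale)
    finally show ?thesis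
      by (simp add: inner_vec_def gradient_def partial_deriv_def mult.commute)
  qed
  then show ?thesis
    using D by presburger
qed

lemma has_real_derivative_along_axis:
  fixes f :: "real ^ 'n::finite \<Rightarrow> real"
  assumes "f differentiable at (x + t *\<^sub>R axis i 1)"
  shows "((\<lambda>s. f (x + s *\<^sub>R axis i 1)) has_real_derivative
           partial_deriv i f (x + t *\<^sub>R axis i 1)) (at t)"
proof -
  have "((\<lambda>s. x + s *\<^sub>R axis i 1) has_derivative (\<lambda>h. h *\<^sub>R axis i 1)) (at t)"
    by (auto intro!: derivative_eq_intros)
  from has_derivative_compose[OF this has_derivative_gradient[OF assms]]
  show ?thesis
    by (simp add: has_field_derivative_def inner_axis gradient_def mult_commute_abs)
qed

text \<open>If \<open>D\<close> were positive, \<open>f'\<close> would be positive just to the right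
  of the critical point \<open>a\<close>, and the mean value theorem would give a larger value
  there. Since \<open>f'\<close> is differentiated at \<open>a\<close> only, this applies to
  functions that are merely \<open>C2\<close>.\<close>

lemma local_max_second_derivative:
  fixes f :: "real \<Rightarrow> real"
  assumes f: "\<And>t. (f has_real_derivative f' t) (at t)"
    and f': "(f' has_real_derivative D) (at a)"
    and "d > 0" and max: "\<And>t. \<bar>t - a\<bar> < d \<Longrightarrow> f t \<le> f a"
  shows "D \<le> 0"
proof (rule ccontr)
  assume "\<not> D \<le> 0"
  have "f' a = 0"
    using DERIV_local_max[OF f[of a] \<open>d > 0\<close>] max by (simp add: abs_minus_commute)
  then obtain e where e: "e > 0" "\<And>h. 0 < h \<Longrightarrow> h < e \<Longrightarrow> f' (a + h) > 0"
    using DERIV_pos_inc_right[OF f'] \<open>\<not> D \<le> 0\<close> by force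
  define b where "b = a + min d e / 2"
  have b: "a < b" "b < a + d" "b < a + e"
    using e(1) \<open>d > 0\<close> by (auto simp: b_def min_def)
  obtain z where "a < z" "z < b" "f b - f a = (b - a) * f' z"
    using MVT2[OF b(1), of f f'] f by blast
  moreover have "f' z > 0"
    using e(2)[of "z - a"] calculation b by simp
  moreover have "f b \<le> f a"
    using max[of b] b by simp
  ultimately show False
    using b by (smt (verit) mult_pos_pos)
qed

lemma C2_D:
  assumes "C2 f"
  shows "f differentiable at x" "partial_deriv i f differentiable at x" "continuous_on S f"
  using assms unfolding C2_def C1_def
  by (auto intro!: continuous_at_imp_continuous_on differentiable_imp_continuous_within)

section \<open>Comparison with a paraboloid\<close>

text \<open>Adding a small enough paraboloid to \<open>u\<close> keeps the Laplacian negative in the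
  ball, so the minimum over the closed ball lies on the sphere. There the paraboloid alone already
  has the claimed size, and at the centre it vanishes.\<close>

lemma ball_lower_bound_of_laplacian_le:
  fixes u :: "real ^ 'n::finite \<Rightarrow> real"
  assumes u: "C2 u" "\<And>x. u x > 0" and "R > 0" "k > 0"
    and lap: "\<And>x. x \<in> ball x0 R \<Longrightarrow> laplacian u x \<le> - k"
  shows "k * R\<^sup>2 / (4 * CARD('n)) \<le> u x0"
proof -
  \<comment> \<open>With this \<open>b\<close> the paraboloid has Laplacian \<open>k / 2\<close>,
    which leaves \<open>w\<close> with Laplacian at most \<open>- k / 2\<close>.\<close>
  define b where "b = k / (4 * CARD('n))"
  have b: "b > 0"
    using \<open>k > 0\<close> by (simp add: b_def)
  define w where "w x = u x + b * ((x - x0) \<bullet> (x - x0))" for x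
  have "continuous_on (cball x0 R) w"
    unfolding w_def by (intro continuous_intros C2_D(3)[OF u(1)])
  then obtain x1 where x1: "x1 \<in> cball x0 R" "\<And>x. x \<in> cball x0 R \<Longrightarrow> w x1 \<le> w x"
    using continuous_attains_inf[of "cball x0 R" w] \<open>R > 0\<close> by auto
  have "x1 \<notin> ball x0 R"
  proof
    assume x1': "x1 \<in> ball x0 R"
    then obtain d where d: "d > 0" "ball x1 d \<subseteq> ball x0 R"
      using open_ball openE by blast
    have "- partial_deriv i (partial_deriv i u) x1 - 2 * b \<le> 0" for i
    proof (rule local_max_second_derivative[where d=d and a=0])
      let ?f' = "\<lambda>t. - partial_deriv i u (x1 + t *\<^sub>R axis i 1) - b * (2 * (x1 - x0) $ i + 2 * t)"
      have eq: "- w (x1 + t *\<^sub>R axis i 1) = - u (x1 + t *\<^sub>R axis i 1)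
          - b * ((x1 - x0) \<bullet> (x1 - x0) + 2 * t * (x1 - x0) $ i + t\<^sup>2)" for t
        by (simp add: w_def algebra_simps inner_axis inner_axis' inner_commute power2_eq_square)
      show "((\<lambda>t. - w (x1 + t *\<^sub>R axis i 1)) has_real_derivative ?f' t) (at t)" for t
        unfolding eq
        by (auto intro!: derivative_eq_intros has_real_derivative_along_axis C2_D[OF u(1)])
      show "(?f' has_real_derivative - partial_deriv i (partial_deriv i u) x1 - 2 * b) (at 0)"
        using has_real_derivative_along_axis[of "partial_deriv i u" x1 0 i] C2_D[OF u(1)]
        by (auto intro!: derivative_eq_intros)
      show "- w (x1 + t *\<^sub>R axis i 1) \<le> - w (x1 + 0 *\<^sub>R axis i 1)" if "\<bar>t - 0\<bar> < d" for t
      proof -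
        have "x1 + t *\<^sub>R axis i 1 \<in> ball x1 d"
          using that by (simp add: dist_norm norm_axis_1)
        then have "x1 + t *\<^sub>R axis i 1 \<in> cball x0 R"
          using d by auto
        then show ?thesis using x1(2) by simp
      qed
    qed (use d in auto)
    then have "(\<Sum>i\<in>UNIV. - partial_deriv i (partial_deriv i u) x1 - 2 * b) \<le> (\<Sum>i\<in>(UNIV::'n set). 0)"
      by (intro sum_mono) auto
    then have "- laplacian u x1 - 2 * b * CARD('n) \<le> 0"
      by (simp add: laplacian_def sum_subtractf sum_negf mult.commute)
    moreover have "2 * b * CARD('n) = k / 2"
      by (simp add: b_def)
    ultimately show False
      using lap[OF x1'] \<open>k > 0\<close> by simp
  qed
  then have "(x1 - x0) \<bullet> (x1 - x0) = R\<^sup>2"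
    using x1(1) by (simp add: power2_norm_eq_inner[symmetric] dist_norm norm_minus_commute)
  then have "b * R\<^sup>2 \<le> w x1"
    using u(2)[of x1] by (simp add: w_def)
  also have "\<dots> \<le> w x0"
    using x1(2)[of x0] \<open>R > 0\<close> by simp
  finally show ?thesis
    by (simp add: w_def b_def)
qed

section \<open>Doubling of variables\<close>

text \<open>The penalty makes the maximum exist: it bounds \<open>x\<close>, and the term with
  \<open>L\<close> then bounds \<open>y\<close>. What matters later is that \<open>\<theta>\<close>
  is fixed before \<open>\<rho>\<close>, so all errors caused by the penalty can be made small
  compared with the gap \<open>\<theta>\<close>.\<close>

lemma penalized_doubling_max:
  fixes v :: "'a::euclidean_space \<Rightarrow> real"
  assumes cont: "continuous_on UNIV v" and bdd: "\<And>x y. v x - v y \<le> V"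
    and "L > 0" and nonlip: "v x0 - v y0 > L * norm (x0 - y0)"
  obtains \<theta> where "\<theta> > 0"
    and "\<And>\<rho>. \<rho> > 0 \<Longrightarrow> \<exists>\<delta> x y. 0 < \<delta> \<and> \<delta> < \<rho> \<and> \<delta> * norm x < \<rho> \<and> \<theta> \<le> v x - v y \<and>
      (\<forall>x' y'. v x' - v y' - L * norm (x' - y') - \<delta> * (x' \<bullet> x')
              \<le> v x - v y - L * norm (x - y) - \<delta> * (x \<bullet> x))"
proof -
  define \<theta> where "\<theta> = (v x0 - v y0 - L * norm (x0 - y0)) / 2"
  have \<theta>: "\<theta> > 0" using nonlip by (simp add: \<theta>_def)
  have "V > 0"
    using bdd[of x0 y0] nonlip mult_nonneg_nonneg[of L "norm (x0 - y0)"] \<open>L > 0\<close>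
    by (smt (verit) norm_ge_zero)
  show thesis
  proof (rule that[OF \<theta>])
    fix \<rho> :: real assume \<rho>: "\<rho> > 0"
    \<comment> \<open>The first bound keeps the penalized value at \<open>(x0, y0)\<close> at least
      \<open>\<theta>\<close>. The last one gives \<open>\<delta> * V < \<rho>\<^sup>2\<close>,
      which controls \<open>\<delta> * norm x\<close> because
      \<open>\<delta> * (x \<bullet> x) \<le> V\<close> at the maximum.\<close>
    define \<delta> where "\<delta> = min (\<theta> / (1 + x0 \<bullet> x0)) (min (\<rho> / 2) (\<rho>\<^sup>2 / (2 * V)))"
    have x0: "0 < 1 + x0 \<bullet> x0" by (simp add: add_pos_nonneg)
    have \<delta>: "0 < \<delta>" "\<delta> < \<rho>"
      using \<theta> \<rho> \<open>V > 0\<close> x0 by (auto simp: \<delta>_def min_less_iff_disj)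
    have "\<delta> * V \<le> \<rho>\<^sup>2 / (2 * V) * V"
      using \<open>V > 0\<close> by (intro mult_right_mono) (auto simp: \<delta>_def)
    also have "\<dots> < \<rho>\<^sup>2" using \<open>V > 0\<close> \<rho> by simp
    finally have \<delta>V: "\<delta> * V < \<rho>\<^sup>2" .
    have "\<delta> * (1 + x0 \<bullet> x0) \<le> \<theta> / (1 + x0 \<bullet> x0) * (1 + x0 \<bullet> x0)"
      using x0 by (intro mult_right_mono) (auto simp: \<delta>_def)
    also have "\<dots> = \<theta>" using x0 by simp
    finally have \<delta>x0: "\<delta> * (x0 \<bullet> x0) \<le> \<theta>"
      unfolding distrib_left using \<delta> by linarith
    define \<Phi> where "\<Phi> z = v (fst z) - v (snd z) - L * norm (fst z - snd z) - \<delta> * (fst z \<bullet> fst z)"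
      for z :: "'a \<times> 'a"
    have \<Phi>0: "\<Phi> (x0, y0) \<ge> \<theta>"
    proof -
      have "\<Phi> (x0, y0) = 2 * \<theta> - \<delta> * (x0 \<bullet> x0)" by (simp add: \<Phi>_def \<theta>_def)
      then show ?thesis using \<delta>x0 by linarith
    qed
    have nonneg: "0 \<le> \<delta> * (x \<bullet> x)" "0 \<le> L * norm (x - y)" for x y :: 'a
      using \<delta> \<open>L > 0\<close> by simp_all
    define A where "A = sqrt (V / \<delta>)"
    define B where "B = V / L"
    \<comment> \<open>\<open>K\<close> contains every pair with value at least
      \<open>\<theta>\<close>, so a maximum over \<open>K\<close> is global.\<close>
    define K where "K = cball (0::'a) A \<times> cball (0::'a) (A + B)"
    have large: "\<delta> * (x \<bullet> x) \<le> V" "L * norm (x - y) \<le> V" if "\<Phi> (x, y) \<ge> \<theta>" for x y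
      using that[unfolded \<Phi>_def fst_conv snd_conv] bdd[of x y] \<theta> nonneg(1)[of x] nonneg(2)[of x y]
      by linarith+
    have inK: "(x, y) \<in> K" if "\<Phi> (x, y) \<ge> \<theta>" for x y
    proof -
      have "(norm x)\<^sup>2 \<le> V / \<delta>"
        using large(1)[OF that] \<delta> by (simp add: power2_norm_eq_inner field_simps)
      then have 1: "norm x \<le> A" by (simp add: A_def real_le_rsqrt)
      have "norm (x - y) \<le> B"
        using large(2)[OF that] \<open>L > 0\<close> by (simp add: B_def field_simps)
      then show ?thesis
        using 1 norm_triangle_sub[of y x] by (simp add: K_def norm_minus_commute)
    qed
    have "continuous_on K (\<lambda>z. v (fst z))" "continuous_on K (\<lambda>z. v (snd z))"
      using continuous_on_compose2[OF cont continuous_on_fst[OF continuous_on_id] subset_UNIV]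
        continuous_on_compose2[OF cont continuous_on_snd[OF continuous_on_id] subset_UNIV] .
    then have cont\<Phi>: "continuous_on K \<Phi>"
      unfolding \<Phi>_def
      by (intro continuous_on_diff continuous_on_mult continuous_on_norm continuous_on_inner
          continuous_on_const continuous_on_fst continuous_on_snd continuous_on_id)
    have "compact K" unfolding K_def by (intro compact_Times compact_cball)
    moreover have "K \<noteq> {}" using inK[OF \<Phi>0] by blast
    ultimately obtain z where z: "z \<in> K" "\<And>z'. z' \<in> K \<Longrightarrow> \<Phi> z' \<le> \<Phi> z"
      using continuous_attains_sup[OF _ _ cont\<Phi>] by blast
    obtain x y where xy: "z = (x, y)" by (cases z)
    have \<Phi>xy: "\<Phi> (x, y) \<ge> \<theta>"
      using z(2)[OF inK[OF \<Phi>0]] \<Phi>0 xy by simp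
    have max: "\<Phi> (x', y') \<le> \<Phi> (x, y)" for x' y'
      using z(2)[of "(x', y')"] inK[of x' y'] \<Phi>xy xy by fastforce
    have "(\<delta> * norm x)\<^sup>2 = \<delta> * (\<delta> * (x \<bullet> x))"
      by (simp add: power_mult_distrib power2_norm_eq_inner) (simp add: power2_eq_square)
    also have "\<dots> \<le> \<delta> * V"
      using large(1)[OF \<Phi>xy] \<delta> by (intro mult_left_mono) auto
    also note \<delta>V
    finally have \<delta>x: "\<delta> * norm x < \<rho>"
      using \<rho> by (simp add: power_less_imp_less_base)
    have vxy: "\<theta> \<le> v x - v y"
      using \<Phi>xy[unfolded \<Phi>_def fst_conv snd_conv] nonneg(1)[of x] nonneg(2)[of x y] by linarith
    show "\<exists>\<delta> x y. 0 < \<delta> \<and> \<delta> < \<rho> \<and> \<delta> * norm x < \<rho> \<and> \<theta> \<le> v x - v y \<and>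
      (\<forall>x' y'. v x' - v y' - L * norm (x' - y') - \<delta> * (x' \<bullet> x')
              \<le> v x - v y - L * norm (x - y) - \<delta> * (x \<bullet> x))"
      by (intro exI[of _ \<delta>] exI[of _ x] exI[of _ y] conjI allI \<delta> \<delta>x vxy
          max[unfolded \<Phi>_def fst_conv snd_conv])
  qed
qed

text \<open>Each variable is at a critical point while the other is frozen; the norm is
  differentiable there because \<open>x \<noteq> y\<close>. The penalty involves \<open>x\<close>
  only, so the gradient at \<open>y\<close> carries no error.\<close>

lemma doubling_max_gradients:
  fixes v :: "'a::euclidean_space \<Rightarrow> real"
  assumes x: "(v has_derivative (\<lambda>h. a \<bullet> h)) (at x)" and y: "(v has_derivative (\<lambda>h. b \<bullet> h)) (at y)"
    and "x \<noteq> y"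
    and max: "\<And>x' y'. v x' - v y' - L * norm (x' - y') - \<delta> * (x' \<bullet> x')
              \<le> v x - v y - L * norm (x - y) - \<delta> * (x \<bullet> x)"
  shows "b = L *\<^sub>R sgn (x - y)" "a = L *\<^sub>R sgn (x - y) + (2 * \<delta>) *\<^sub>R x"
proof -
  have max_y: "- v z - L * norm (x - z) \<le> - v y - L * norm (x - y)" for z
    using max[of x z] by simp
  have max_x: "v z - L * norm (z - y) - \<delta> * (z \<bullet> z)
      \<le> v x - L * norm (x - y) - \<delta> * (x \<bullet> x)" for z
    using max[of z y] by simp
  have N: "((\<lambda>z. norm (z - c)) has_derivative (\<lambda>h. h \<bullet> sgn (w - c))) (at w)" if "w \<noteq> c" for c w :: 'a
    using has_derivative_compose[OF has_derivative_diff[OF has_derivative_ident has_derivative_const]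
        has_derivative_norm, of w c] that by simp
  have "((\<lambda>z. - v z - L * norm (z - x)) has_derivative
         (\<lambda>h. - (b \<bullet> h) - L * (h \<bullet> sgn (y - x)))) (at y)"
    using \<open>x \<noteq> y\<close> by (auto intro!: derivative_eq_intros y N)
  then have "((\<lambda>z. - v z - L * norm (x - z)) has_derivative
         (\<lambda>h. - (b \<bullet> h) + L * (h \<bullet> sgn (x - y)))) (at y)"
    using sgn_minus[of "y - x"] by (simp add: norm_minus_commute)
  then have "(\<lambda>h. - (b \<bullet> h) + L * (h \<bullet> sgn (x - y))) = (\<lambda>h. 0)"
    by (rule differential_zero_maxmin[where S = UNIV, rotated 2]) (use max_y in auto)
  from fun_cong[OF this] have b: "h \<bullet> b = h \<bullet> (L *\<^sub>R sgn (x - y))" for h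
    by (simp add: inner_commute[of h b])
  show "b = L *\<^sub>R sgn (x - y)"
    by (rule vector_eq_ldot[THEN iffD1], rule allI, rule b)
  have "((\<lambda>z. v z - L * norm (z - y) - \<delta> * (z \<bullet> z)) has_derivative
         (\<lambda>h. a \<bullet> h - L * (h \<bullet> sgn (x - y)) - \<delta> * (2 * (h \<bullet> x)))) (at x)"
    using \<open>x \<noteq> y\<close> by (auto intro!: derivative_eq_intros x N simp: inner_commute)
  then have "(\<lambda>h. a \<bullet> h - L * (h \<bullet> sgn (x - y)) - \<delta> * (2 * (h \<bullet> x))) = (\<lambda>h. 0)"
    by (rule differential_zero_maxmin[where S = UNIV, rotated 2]) (use max_x in auto)
  from fun_cong[OF this] have a: "h \<bullet> a = h \<bullet> (L *\<^sub>R sgn (x - y) + (2 * \<delta>) *\<^sub>R x)" for h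
    by (simp add: inner_commute[of h a] inner_add_right algebra_simps)
  show "a = L *\<^sub>R sgn (x - y) + (2 * \<delta>) *\<^sub>R x"
    by (rule vector_eq_ldot[THEN iffD1], rule allI, rule a)
qed

section \<open>The transformed equation\<close>

text \<open>This is the quantitative decrease of \<open>F\<close> in \<open>u\<close> at gradient
  norm \<open>L\<close>, with \<open>A = M * L powr q\<close>. The terms from
  \<open>s powr p / g s\<close> have slope at most \<open>2 * (p + 1) * m powr (p - 1)\<close>. The
  factor 8 in \<open>A\<close> makes the other term fall at least twice as fast, because
  \<open>g s powr (q - 2) \<ge> 1\<close> for \<open>q < 2\<close>.\<close>

lemma reaction_decreasing:
  fixes m p q A s t :: real
  assumes "p > 1" "1 < q" "q < 2" "0 < t" "t \<le> s" "s \<le> m"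
    and A: "(q - 1) * A = 8 * (p + 1) * m powr p"
  defines "g \<equiv> \<lambda>s. 1 - s / (2 * m)"
  shows "2 * (p + 1) * m powr (p - 1) * (s - t)
    \<le> (t powr p / g t + A * g t powr (q - 1)) - (s powr p / g s + A * g s powr (q - 1))"
proof -
  define \<kappa> where "\<kappa> = 2 * (p + 1) * m powr (p - 1)"
  have m: "m > 0" using assms by simp
  have "0 < (q - 1) * A"
    unfolding A using m \<open>p > 1\<close> by (intro mult_pos_pos) auto
  then have "A > 0" using \<open>1 < q\<close> by (simp add: zero_less_mult_iff)
  have mp: "m powr p = m * m powr (p - 1)"
    using powr_add[of m 1 "p - 1"] m by simp
  \<comment> \<open>Adding \<open>\<kappa> * s\<close> reduces the quantitative decrease to plain
    monotonicity.\<close>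
  have "s powr p / g s + A * g s powr (q - 1) + \<kappa> * s \<le> t powr p / g t + A * g t powr (q - 1) + \<kappa> * t"
  proof (rule DERIV_nonpos_imp_nonincreasing[OF \<open>t \<le> s\<close>])
    fix r assume "t \<le> r" "r \<le> s"
    then have r: "0 < r" "r \<le> m" using assms by auto
    have g: "1 / 2 \<le> g r" "g r \<le> 1"
      using r m by (auto simp: g_def field_simps)
    let ?D = "p * r powr (p - 1) / g r + r powr p / (2 * m * (g r)\<^sup>2)
        - A * (q - 1) * g r powr (q - 2) / (2 * m) + \<kappa>"
    have dg: "(g has_real_derivative - 1 / (2 * m)) (at r)"
      unfolding g_def using m by (auto intro!: derivative_eq_intros)
    have "((\<lambda>r. r powr p / g r) has_real_derivative
        (p * r powr (p - 1) * g r - r powr p * (- 1 / (2 * m))) / (g r * g r)) (at r)"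
      using r g by (intro DERIV_divide dg has_real_derivative_powr) auto
    moreover have "((\<lambda>r. g r powr (q - 1)) has_real_derivative
        (q - 1) * g r powr (q - 1 - 1) * (- 1 / (2 * m))) (at r)"
      by (rule DERIV_chain2[OF has_real_derivative_powr dg]) (use g in auto)
    ultimately have "((\<lambda>r. r powr p / g r + A * g r powr (q - 1) + \<kappa> * r) has_real_derivative
        (p * r powr (p - 1) * g r - r powr p * (- 1 / (2 * m))) / (g r * g r)
          + A * ((q - 1) * g r powr (q - 1 - 1) * (- 1 / (2 * m))) + \<kappa> * 1) (at r)"
      by (intro DERIV_add DERIV_cmult DERIV_ident)
    moreover have "(p * r powr (p - 1) * g r - r powr p * (- 1 / (2 * m))) / (g r * g r)
        = p * r powr (p - 1) / g r + r powr p / (2 * m * (g r)\<^sup>2)"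
      using g by (simp add: add_divide_distrib power2_eq_square)
    ultimately have "((\<lambda>r. r powr p / g r + A * g r powr (q - 1) + \<kappa> * r) has_real_derivative ?D) (at r)"
      by (simp add: mult.assoc)
    moreover have "?D \<le> 0"
    proof -
      have 1: "p * r powr (p - 1) / g r \<le> p * m powr (p - 1) / (1 / 2)"
        using r g \<open>p > 1\<close> by (intro frac_le mult_left_mono powr_mono2) auto
      have "1 / 2 * (1 / 2) \<le> g r * g r" using g by (intro mult_mono) auto
      then have "r powr p / (2 * m * (g r)\<^sup>2) \<le> m powr p / (2 * m * (1 / 4))"
        using r g \<open>p > 1\<close> m by (intro frac_le mult_left_mono powr_mono2) (auto simp: power2_eq_square)
      then have 2: "r powr p / (2 * m * (g r)\<^sup>2) \<le> 2 * m powr (p - 1)"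
        using m by (simp add: mp)
      have "1 \<le> g r powr (q - 2)"
        using powr_mono2'[of "q - 2" "g r" 1] g \<open>q < 2\<close> by simp
      then have "A * (q - 1) / (2 * m) * 1 \<le> A * (q - 1) / (2 * m) * g r powr (q - 2)"
        using \<open>A > 0\<close> \<open>1 < q\<close> m by (intro mult_left_mono) auto
      moreover have "A * (q - 1) / (2 * m) * 1 = 4 * (p + 1) * m powr (p - 1)"
        using A m by (simp add: mp mult.commute)
      ultimately have 3: "4 * (p + 1) * m powr (p - 1) \<le> A * (q - 1) * g r powr (q - 2) / (2 * m)"
        by (simp only: times_divide_eq_left)
      show ?thesis
        using 1 2 3 by (simp add: \<kappa>_def algebra_simps)
    qed
    ultimately show "\<exists>D. ((\<lambda>r. r powr p / g r + A * g r powr (q - 1) + \<kappa> * r) has_real_derivative D) (at r)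
        \<and> D \<le> 0" by blast
  qed
  then show ?thesis
    by (simp add: \<kappa>_def algebra_simps)
qed

text \<open>The derivative of \<open>G\<close> is \<open>1 / (1 - s / (2 * m))\<close>, which lies
  between 1 and 2 on \<open>(0, m]\<close>. The lower bound carries a failure of the Lipschitz bound
  from \<open>u\<close> to \<open>v\<close>; the upper one turns a gap in \<open>v\<close> back into
  a gap in \<open>u\<close>.\<close>

lemma log_change_of_variable_bounds:
  fixes m s t :: real
  assumes "0 < t" "t \<le> s" "s \<le> m"
  defines "G \<equiv> \<lambda>s. - 2 * m * ln (1 - s / (2 * m))"
  shows "s - t \<le> G s - G t" "G s - G t \<le> 2 * (s - t)"
proof -
  have der: "(G has_real_derivative 1 / (1 - r / (2 * m))) (at r)" if "0 < r" "r \<le> m" for r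
    unfolding G_def using that
    by (auto intro!: derivative_eq_intros simp: field_simps)
  have bounds: "1 \<le> 1 / (1 - r / (2 * m))" "1 / (1 - r / (2 * m)) \<le> 2" if "0 < r" "r \<le> m" for r
    using that by (auto simp: field_simps)
  have "(\<lambda>r. G r - r) t \<le> (\<lambda>r. G r - r) s"
    by (rule DERIV_nonneg_imp_nondecreasing[OF \<open>t \<le> s\<close>],
        rule exI, rule conjI, rule DERIV_diff[OF der DERIV_ident])
      (use assms bounds in auto)
  then show "s - t \<le> G s - G t" by simp
  have "(\<lambda>r. G r - 2 * r) s \<le> (\<lambda>r. G r - 2 * r) t"
    by (rule DERIV_nonpos_imp_nonincreasing[OF \<open>t \<le> s\<close>],
        rule exI, rule conjI, rule DERIV_diff[OF der DERIV_cmult[OF DERIV_ident]])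
      (use assms bounds in auto)
  then show "G s - G t \<le> 2 * (s - t)" by simp
qed

text \<open>Here \<open>G\<close> is the change of unknown, \<open>v = G \<circ> u\<close>, and \<open>lap\<close> is the Laplacian of \<open>v\<close>.\<close>
lemma doubling_max_second_derivatives:
  fixes u :: "real ^ 'n::finite \<Rightarrow> real" and G g :: "real \<Rightarrow> real"
  assumes u: "C2 u" and uI: "\<And>z. u z \<in> I"
    and G: "\<And>s. s \<in> I \<Longrightarrow> (G has_real_derivative 1 / g s) (at s)"
    and g: "\<And>s. s \<in> I \<Longrightarrow> (g has_real_derivative - a) (at s)" "\<And>s. s \<in> I \<Longrightarrow> g s > 0"
    and max: "\<And>x' y'. G (u x') - G (u y') - L * norm (x' - y') - \<delta> * (x' \<bullet> x')
              \<le> G (u x) - G (u y) - L * norm (x - y) - \<delta> * (x \<bullet> x)"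
  defines "lap z \<equiv> laplacian u z / g (u z) + a * (norm (gradient u z /\<^sub>R g (u z)))\<^sup>2"
  shows "lap x - lap y \<le> 2 * \<delta> * CARD('n)"
proof -
  \<comment> \<open>This is the second derivative of \<open>v\<close> along axis \<open>i\<close>;
    the square comes from differentiating \<open>1 / g\<close>, since \<open>g\<close> has slope
    \<open>- a\<close>.\<close>
  define D2 where "D2 i z = partial_deriv i (partial_deriv i u) z / g (u z)
      + a * (partial_deriv i u z / g (u z))\<^sup>2" for i z
  have lap: "lap z = (\<Sum>i\<in>UNIV. D2 i z)" for z
  proof -
    have "(norm (gradient u z /\<^sub>R g (u z)))\<^sup>2 = (\<Sum>i\<in>UNIV. (partial_deriv i u z / g (u z))\<^sup>2)"
      unfolding power2_norm_eq_inner
      by (simp add: inner_vec_def gradient_def power2_eq_square divide_inverse mult_ac)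
    then show ?thesis
      by (simp add: lap_def D2_def laplacian_def sum.distrib sum_divide_distrib sum_distrib_left)
  qed
  have "D2 i x - D2 i y - 2 * \<delta> \<le> 0" for i
  proof (rule local_max_second_derivative[where d = 1 and a = 0])
    let ?d = "\<lambda>z t. partial_deriv i u (z + t *\<^sub>R axis i 1) / g (u (z + t *\<^sub>R axis i 1))"
    \<comment> \<open>Both points receive the same shift, so the norm term is constant and only the
      penalty adds curvature, \<open>2 * \<delta>\<close> per axis.\<close>
    let ?f = "\<lambda>t. G (u (x + t *\<^sub>R axis i 1)) - G (u (y + t *\<^sub>R axis i 1)) - L * norm (x - y)
      - \<delta> * (x \<bullet> x + 2 * t * x $ i + t\<^sup>2)"
    let ?f' = "\<lambda>t. ?d x t - ?d y t - \<delta> * (2 * x $ i + 2 * t)"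
    have 1: "((\<lambda>t. G (u (z + t *\<^sub>R axis i 1))) has_real_derivative ?d z t) (at t)" for z t
      using DERIV_chain2[OF G[OF uI] has_real_derivative_along_axis[OF C2_D(1)[OF u]]] by simp
    have 2: "(?d z has_real_derivative D2 i z) (at 0)" for z
    proof -
      have axis0: "((\<lambda>t. f (z + t *\<^sub>R axis i 1)) has_real_derivative partial_deriv i f z) (at 0)"
        if "f differentiable at z" for f
        using has_real_derivative_along_axis[of f z 0 i] that by simp
      note d1 = axis0[OF C2_D(2)[OF u, where i = i]]
      have d2: "((\<lambda>t. g (u (z + t *\<^sub>R axis i 1))) has_real_derivative
          - a * partial_deriv i u z) (at 0)"
        by (rule DERIV_chain2[where f = g, OF _ axis0[OF C2_D(1)[OF u]]]) (use g(1)[OF uI] in simp)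
      have "g (u z) > 0" using g(2) uI by blast
      then show ?thesis
        using DERIV_divide[OF d1 d2]
        by (simp add: D2_def add_divide_distrib power2_eq_square mult_ac)
    qed
    show "(?f has_real_derivative ?f' t) (at t)" for t
      by (auto intro!: derivative_eq_intros 1)
    show "(?f' has_real_derivative D2 i x - D2 i y - 2 * \<delta>) (at 0)"
      by (rule DERIV_diff[OF DERIV_diff[OF 2 2]]) (auto intro!: derivative_eq_intros)
    have eq: "(x + t *\<^sub>R axis i 1) \<bullet> (x + t *\<^sub>R axis i 1) = x \<bullet> x + 2 * t * x $ i + t\<^sup>2" for t
      by (simp add: algebra_simps inner_axis inner_axis' power2_eq_square)
    show "?f t \<le> ?f 0" for t
      using max[of "x + t *\<^sub>R axis i 1" "y + t *\<^sub>R axis i 1"] unfolding eq by simp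
  qed simp
  then have "(\<Sum>i\<in>UNIV. D2 i x - D2 i y) \<le> (\<Sum>i\<in>(UNIV::'n set). 2 * \<delta>)"
    by (intro sum_mono) (simp add: algebra_simps)
  then show ?thesis
    by (simp add: lap sum_subtractf mult_ac)
qed

section \<open>The Lipschitz bound\<close>

text \<open>At the doubling maximum the decrease of the reaction forces a discrepancy of at least
  \<open>\<kappa> * \<theta> / 2\<close>, whereas the second-order condition and the closeness of
  both gradient norms to \<open>L\<close> allow strictly less.\<close>

lemma classical_solution_lipschitz:
  fixes u :: "real ^ 'n::finite \<Rightarrow> real"
  assumes sol: "classical_solution p q M u" and u: "\<And>x. 0 < u x" "\<And>x. u x \<le> m"
    and pq: "p > 1" "1 < q" "q < 2" and "M > 0" "L > 0"
    and L: "(q - 1) * (M * L powr q) = 8 * (p + 1) * m powr p"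
  shows "u x - u y \<le> L * norm (x - y)"
proof (rule ccontr)
  assume "\<not> u x - u y \<le> L * norm (x - y)"
  then have nonlip: "u x - u y > L * norm (x - y)" by simp
  define a where "a = 1 / (2 * m)"
  define g where "g = (\<lambda>s. 1 - s / (2 * m))"
  define G where "G = (\<lambda>s. - 2 * m * ln (1 - s / (2 * m)))"
  have m: "m > 0" using u[of undefined] by linarith
  have C2: "C2 u"
    and eqn: "\<And>x. - laplacian u x = u x powr p + M * norm (gradient u x) powr q"
    using sol u(1) less_imp_le[OF u(1)] unfolding classical_solution_def
    by (auto simp: powr_mult_base mult.commute)
  have g: "1 / 2 \<le> g s" "g s < 1" "(g has_real_derivative - a) (at s)"
    "(G has_real_derivative 1 / g s) (at s)" if "s \<in> {0<..m}" for s
    using that m by (auto intro!: derivative_eq_intros simp: g_def G_def a_def field_simps)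
  have G_bounds: "s - t \<le> G s - G t" "G s - G t \<le> 2 * (s - t)" if "0 < t" "t \<le> s" "s \<le> m" for s t
    using log_change_of_variable_bounds[OF that] by (simp_all add: G_def)
  have G_diff: "G s - G t \<le> 2 * \<bar>s - t\<bar>" if "s \<in> {0<..m}" "t \<in> {0<..m}" for s t
  proof (cases "t \<le> s")
    case False
    then show ?thesis using G_bounds(1)[of s t] that by auto
  qed (use G_bounds(2)[of t s] that in auto)
  have uI: "u z \<in> {0<..m}" for z using u by auto
  have cont: "continuous_on UNIV (\<lambda>z. G (u z))"
  proof (rule continuous_on_compose2[OF _ C2_D(3)[OF C2]])
    show "continuous_on {0<..m} G"
      using g(4) by (intro DERIV_continuous_on) (auto intro: has_field_derivative_at_within)
  qed (use uI in auto)
  have Gbdd: "G (u z) - G (u z') \<le> 2 * m" for z z'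
    using G_diff[OF uI uI, of z z'] u[of z] u[of z'] by (auto simp: abs_if split: if_splits)
  have "u y \<le> u x" using nonlip \<open>L > 0\<close> by (smt (verit) mult_nonneg_nonneg norm_ge_zero)
  then have Gnonlip: "G (u x) - G (u y) > L * norm (x - y)"
    using G_bounds(1)[of "u y" "u x"] u nonlip by (meson less_le_trans)
  obtain \<theta> where \<theta>: "\<theta> > 0" and \<theta>_max: "\<And>\<rho>. \<rho> > 0 \<Longrightarrow>
      \<exists>\<delta> x y. 0 < \<delta> \<and> \<delta> < \<rho> \<and> \<delta> * norm x < \<rho> \<and> \<theta> \<le> G (u x) - G (u y) \<and>
        (\<forall>x' y'. G (u x') - G (u y') - L * norm (x' - y') - \<delta> * (x' \<bullet> x')
                \<le> G (u x) - G (u y) - L * norm (x - y) - \<delta> * (x \<bullet> x))"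
    using penalized_doubling_max[OF cont Gbdd \<open>L > 0\<close> Gnonlip] by blast
  define \<kappa> where "\<kappa> = 2 * (p + 1) * m powr (p - 1)"
  \<comment> \<open>\<open>G\<close> has slope at most 2, so a gap \<open>\<theta>\<close> in
    \<open>v\<close> is a gap of at least \<open>\<theta> / 2\<close> in \<open>u\<close>.\<close>
  define \<eta> where "\<eta> = \<kappa> * \<theta> / 2"
  have \<kappa>: "\<kappa> > 0" using m pq by (simp add: \<kappa>_def)
  then have \<eta>: "\<eta> > 0" using \<theta> by (simp add: \<eta>_def)
  \<comment> \<open>\<open>\<omega>\<close> dominates the change of \<open>F(u, s)\<close> when \<open>s\<close> is replaced by \<open>L\<close>, uniformly in \<open>u\<close>.\<close>
  define \<omega> where "\<omega> s = a * \<bar>L\<^sup>2 - s\<^sup>2\<bar> + M * \<bar>s powr q - L powr q\<bar>" for s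
  have "isCont \<omega> L"
    unfolding \<omega>_def using \<open>L > 0\<close> by (intro continuous_intros) auto
  then have "\<forall>\<^sub>F s in at L. \<omega> s < \<eta> / 2"
    unfolding isCont_def by (rule order_tendstoD(2)) (use \<eta> in \<open>simp add: \<omega>_def\<close>)
  then obtain r where r: "r > 0" "\<And>s. s \<noteq> L \<Longrightarrow> \<bar>s - L\<bar> < r \<Longrightarrow> \<omega> s < \<eta> / 2"
    unfolding eventually_at by (auto simp: dist_real_def)
  have \<omega>: "\<omega> s < \<eta> / 2" if "\<bar>s - L\<bar> < r" for s
    using r(2)[of s] that \<eta> by (cases "s = L") (auto simp: \<omega>_def)
  \<comment> \<open>The gradient norm at \<open>x\<close> differs from \<open>L\<close> by at most
    \<open>2 * \<delta> * norm x\<close>, whence \<open>r / 2\<close>; the other bound keeps the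
    second-order error \<open>2 * \<delta> * CARD('n)\<close> below
    \<open>\<eta> / 2\<close>.\<close>
  define \<rho> where "\<rho> = min (r / 2) (\<eta> / (4 * CARD('n)))"
  have "\<rho> > 0" using \<open>r > 0\<close> \<eta> by (simp add: \<rho>_def)
  from \<theta>_max[OF this] obtain \<delta> x y where \<delta>: "0 < \<delta>" "\<delta> < \<rho>" "\<delta> * norm x < \<rho>"
    and xy: "\<theta> \<le> G (u x) - G (u y)"
    and max: "\<And>x' y'. G (u x') - G (u y') - L * norm (x' - y') - \<delta> * (x' \<bullet> x')
                \<le> G (u x) - G (u y) - L * norm (x - y) - \<delta> * (x \<bullet> x)" by blast
  have "x \<noteq> y" using xy \<theta> by auto
  have grad: "((\<lambda>z. G (u z)) has_derivative (\<lambda>h. (gradient u z /\<^sub>R g (u z)) \<bullet> h)) (at z)" for z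
    using DERIV_compose_FDERIV[OF g(4)[OF uI] has_derivative_gradient[OF C2_D(1)[OF C2]]]
    by (simp add: divide_inverse mult.commute)
  define X where "X = gradient u x /\<^sub>R g (u x)"
  define Y where "Y = gradient u y /\<^sub>R g (u y)"
  have Y: "Y = L *\<^sub>R sgn (x - y)" and X: "X = L *\<^sub>R sgn (x - y) + (2 * \<delta>) *\<^sub>R x"
    unfolding X_def Y_def using doubling_max_gradients[OF grad grad \<open>x \<noteq> y\<close> max] by auto
  have nY: "norm Y = L" using Y \<open>x \<noteq> y\<close> \<open>L > 0\<close> by (simp add: norm_sgn)
  have "\<bar>norm X - L\<bar> \<le> norm (X - Y)" using norm_triangle_ineq3[of X Y] nY by simp
  also have "\<dots> = 2 * (\<delta> * norm x)" using X Y \<delta>(1) by simp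
  also have "\<dots> < r" using \<delta>(3) by (simp add: \<rho>_def)
  finally have \<omega>X: "\<omega> (norm X) < \<eta> / 2" by (rule \<omega>)
  \<comment> \<open>Dividing the equation by \<open>g\<close> and writing the gradient of
    \<open>u\<close> as \<open>g\<close> times that of \<open>v\<close> leaves the power
    \<open>q - 1\<close> of \<open>g\<close>.\<close>
  have lap: "laplacian u z / g (u z) =
      - (u z powr p / g (u z) + M * g (u z) powr (q - 1) * norm (gradient u z /\<^sub>R g (u z)) powr q)" for z
  proof -
    have gz: "g (u z) > 0" using g(1)[OF uI[of z]] by simp
    define n where "n = norm (gradient u z /\<^sub>R g (u z))"
    have n0: "n \<ge> 0" by (simp add: n_def)
    have "norm (gradient u z) = g (u z) * n" using gz by (simp add: n_def)
    then have "norm (gradient u z) powr q = g (u z) powr (q - 1) * n powr q * g (u z)"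
      using gz n0 powr_add[of "g (u z)" "q - 1" 1] by (simp add: powr_mult)
    moreover have "laplacian u z = - (u z powr p + M * norm (gradient u z) powr q)"
      using eqn[of z] by simp
    ultimately have "laplacian u z =
        - (u z powr p + M * g (u z) powr (q - 1) * n powr q * g (u z))" by simp
    then show ?thesis
      using gz unfolding n_def[symmetric] by (simp add: diff_divide_distrib)
  qed
  have "(laplacian u x / g (u x) + a * (norm X)\<^sup>2) - (laplacian u y / g (u y) + a * (norm Y)\<^sup>2)
      \<le> 2 * \<delta> * CARD('n)"
    unfolding X_def Y_def
    by (rule doubling_max_second_derivatives[where I = "{0<..m}" and G = G and L = L])
       (use C2 uI g max in \<open>auto intro: less_le_trans[of 0 "1/2"]\<close>)
  then have 1: "(u y powr p / g (u y) + M * L powr q * g (u y) powr (q - 1))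
      - (u x powr p / g (u x) + M * norm X powr q * g (u x) powr (q - 1))
      \<le> 2 * \<delta> * CARD('n) + a * (L\<^sup>2 - (norm X)\<^sup>2)"
    unfolding lap X_def[symmetric] Y_def[symmetric] nY by (simp add: algebra_simps)
  have "G (u x) > G (u y)" using xy \<theta> by simp
  then have uyx: "u y \<le> u x" using G_bounds(1)[of "u x" "u y"] u[of x] u[of y] by force
  then have 2: "\<kappa> * (u x - u y) \<le> (u y powr p / g (u y) + M * L powr q * g (u y) powr (q - 1))
      - (u x powr p / g (u x) + M * L powr q * g (u x) powr (q - 1))"
    unfolding \<kappa>_def g_def using u pq L by (intro reaction_decreasing) auto
  \<comment> \<open>Since this factor is at most 1, replacing \<open>norm X\<close> by
    \<open>L\<close> in the reaction at \<open>x\<close> costs no more than the second summand of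
    \<open>\<omega>\<close>, whatever the value of \<open>u x\<close>.\<close>
  have gx: "0 \<le> g (u x) powr (q - 1)" "g (u x) powr (q - 1) \<le> 1"
    using g(1,2)[OF uI[of x]] pq by (auto intro!: powr_le1)
  have "g (u x) powr (q - 1) * (M * (norm X powr q - L powr q))
      \<le> g (u x) powr (q - 1) * (M * \<bar>norm X powr q - L powr q\<bar>)"
    using gx \<open>M > 0\<close> by (intro mult_left_mono) auto
  also have "\<dots> \<le> 1 * (M * \<bar>norm X powr q - L powr q\<bar>)"
    using gx \<open>M > 0\<close> by (intro mult_right_mono) auto
  finally have "g (u x) powr (q - 1) * (M * (norm X powr q - L powr q))
      \<le> M * \<bar>norm X powr q - L powr q\<bar>" by simp
  moreover have "a * (L\<^sup>2 - (norm X)\<^sup>2) \<le> a * \<bar>L\<^sup>2 - (norm X)\<^sup>2\<bar>"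
    using m by (intro mult_left_mono) (auto simp: a_def)
  ultimately have "\<kappa> * (u x - u y) \<le> 2 * \<delta> * CARD('n) + \<omega> (norm X)"
    using 1 2 by (simp add: \<omega>_def algebra_simps)
  also have "\<dots> < \<eta> / 2 + \<eta> / 2"
  proof (rule add_strict_mono[OF _ \<omega>X])
    have "\<delta> < \<eta> / (4 * CARD('n))" using \<delta>(2) by (simp add: \<rho>_def)
    then show "2 * \<delta> * CARD('n) < \<eta> / 2" by (simp add: field_simps)
  qed
  finally have "\<kappa> * (u x - u y) < \<kappa> * (\<theta> / 2)" by (simp add: \<eta>_def)
  then have "u x - u y < \<theta> / 2" using \<kappa> by simp
  then show False using G_bounds(2)[of "u y" "u x"] uyx u[of x] u[of y] xy by simp
qed

section \<open>Scaling and the choice of the constant\<close>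

theorem theoremA:
  fixes p q :: real
  assumes "p > 1" and "1 < q" and "q < 2 * p / (p + 1)"
  shows "\<exists>c>0. \<forall>M>0. \<not> (\<exists>u :: real ^ 'n::finite \<Rightarrow> real.
           classical_solution p q M u \<and> (\<forall>x. u x > 0) \<and>
           (\<forall>x. u x \<le> c * M powr (2 / (2 * p - (p + 1) * q))))"
proof -
  define d where "d = 2 * p - (p + 1) * q"
  have d: "d > 0" using assms by (simp add: d_def field_simps)
  have "2 * p / (p + 1) < 2" using \<open>p > 1\<close> by (simp add: field_simps)
  then have "q < 2" using assms by simp
  \<comment> \<open>\<open>A\<close> is the constant in
    \<open>m powr (p + 1) \<le> A * L\<^sup>2\<close>: 64 is 4 from the paraboloid times 16 from
    \<open>R\<^sup>2\<close>, and \<open>2 powr p\<close> comes from \<open>(m / 2) powr p\<close>.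
    \<open>B\<close> results from inserting \<open>L powr q\<close>, which gives
    \<open>M \<le> B * m powr (d / 2)\<close>; \<open>c\<close> is chosen so that
    \<open>B * c powr (d / 2) = 1 / 2\<close>.\<close>
  define A where "A = 64 * CARD('n) * 2 powr p"
  define B where "B = A powr (q / 2) * (8 * (p + 1) / (q - 1))"
  define c where "c = (1 / (2 * B)) powr (2 / d)"
  have "A > 0" by (simp add: A_def)
  then have "B > 0" using assms by (simp add: B_def)
  then have c: "c > 0" by (simp add: c_def)
  have False if "M > 0" and sol: "classical_solution p q M u" and pos: "\<And>x. u x > 0"
    and le: "\<And>x. u x \<le> c * M powr (2 / d)" for M and u :: "real ^ 'n \<Rightarrow> real"
  proof -
    have bdd: "bdd_above (range u)" using le by (intro bdd_aboveI) auto
    define m where "m = (SUP x. u x)"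
    have um: "u x \<le> m" for x unfolding m_def by (rule cSUP_upper[OF _ bdd]) simp
    have m: "m > 0" using um[of 0] pos[of 0] by simp
    have mle: "m \<le> c * M powr (2 / d)" unfolding m_def by (rule cSUP_least) (use le in auto)
    define L where "L = (8 * (p + 1) * m powr p / ((q - 1) * M)) powr (1 / q)"
    have "L > 0" using assms m \<open>M > 0\<close> by (simp add: L_def)
    have Lq: "L powr q = 8 * (p + 1) * m powr p / ((q - 1) * M)"
      using assms m \<open>M > 0\<close> by (simp add: L_def powr_powr)
    then have "(q - 1) * (M * L powr q) = 8 * (p + 1) * m powr p"
      using assms \<open>M > 0\<close> by simp
    note lip = classical_solution_lipschitz[OF sol pos um assms(1,2) \<open>q < 2\<close> \<open>M > 0\<close> \<open>L > 0\<close> this]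
    \<comment> \<open>The supremum may not be attained. From a value above \<open>3 / 4 * m\<close>,
      a drop of at most \<open>m / 4\<close> within radius \<open>R\<close> still leaves
      \<open>u \<ge> m / 2\<close>.\<close>
    have "\<exists>x. 3 / 4 * m < u x"
      using less_cSUP_iff[OF _ bdd, of "3 / 4 * m"] m by (auto simp: m_def)
    then obtain x0 where x0: "3 / 4 * m < u x0" by blast
    define R where "R = m / (4 * L)"
    have "R > 0" using m \<open>L > 0\<close> by (simp add: R_def)
    have C2: "C2 u" using sol by (simp add: classical_solution_def)
    have "(m / 2) powr p * R\<^sup>2 / (4 * CARD('n)) \<le> u x0"
    proof (rule ball_lower_bound_of_laplacian_le[OF C2 pos \<open>R > 0\<close>])
      show "(m / 2) powr p > 0" using m by simp
      fix x assume "x \<in> ball x0 R"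
      then have "L * norm (x0 - x) \<le> L * R"
        using \<open>L > 0\<close> by (intro mult_left_mono) (auto simp: dist_norm)
      also have "\<dots> = m / 4" using \<open>L > 0\<close> by (simp add: R_def)
      finally have "m / 2 \<le> u x" using lip[of x0 x] x0 by simp
      then have "(m / 2) powr p \<le> u x powr p" using m assms by (intro powr_mono2) auto
      also have "\<dots> = u x powr (p - 1) * u x" using pos[of x] powr_add[of "u x" "p - 1" 1] by simp
      also have "\<dots> \<le> - laplacian u x"
        using sol pos[of x] \<open>M > 0\<close> by (simp add: classical_solution_def)
      finally show "laplacian u x \<le> - ((m / 2) powr p)" by simp
    qed
    also have "u x0 \<le> m" by (rule um)
    finally have "(m / 2) powr p * R\<^sup>2 / (4 * CARD('n)) \<le> m" .
    then have "m powr p * m * m \<le> A * L\<^sup>2 * m"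
      using \<open>L > 0\<close> m by (simp add: R_def A_def powr_divide field_simps power2_eq_square)
    then have "m powr p * m \<le> A * L\<^sup>2" using m by simp
    then have "m powr (p + 1) \<le> A * L\<^sup>2" using m by (simp add: powr_add)
    \<comment> \<open>The power \<open>q / 2\<close> turns \<open>L\<^sup>2\<close> into
      \<open>L powr q\<close>, which is known in terms of \<open>m\<close> and
      \<open>M\<close>.\<close>
    then have "(m powr (p + 1)) powr (q / 2) \<le> (A * L\<^sup>2) powr (q / 2)"
      using assms by (intro powr_mono2) auto
    also have "\<dots> = A powr (q / 2) * L powr q"
      using \<open>A > 0\<close> \<open>L > 0\<close> by (simp add: powr_mult powr_powr flip: powr_numeral)
    also have "\<dots> = B * m powr p / M"
      using \<open>M > 0\<close> assms by (simp add: Lq B_def)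
    finally have "M * m powr ((p + 1) * q / 2) \<le> B * m powr p"
      using \<open>M > 0\<close> by (simp add: powr_powr field_simps)
    \<comment> \<open>The surplus exponent \<open>d / 2\<close> is positive exactly because
      \<open>q < 2 * p / (p + 1)\<close>; hence an upper bound on \<open>m\<close> bounds the
      right-hand side.\<close>
    also have "m powr p = m powr (d / 2) * m powr ((p + 1) * q / 2)"
      by (simp add: d_def diff_divide_distrib flip: powr_add)
    finally have "M \<le> B * m powr (d / 2)" using m by (simp flip: mult.assoc)
    also have "\<dots> \<le> B * (c * M powr (2 / d)) powr (d / 2)"
      using mle m d \<open>B > 0\<close> by (intro mult_left_mono powr_mono2) auto
    also have "\<dots> = M / 2"
      using \<open>M > 0\<close> \<open>B > 0\<close> c d by (simp add: powr_mult powr_powr c_def)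
    finally show False using \<open>M > 0\<close> by simp
  qed
  then show ?thesis using c unfolding d_def by blast
qed

end
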